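(* Let $c,x\in\mathbb{R}$ with $cx(x+1)\neq 0$, let $P(n)=a_3n^3+a_2n^2+a_1n+a_0$ with $a_0,a_1,a_2,a_3\in\mathbb{R}$, and let $r\ge 0$ be a real number. Suppose that the real sequence $\{u_n\}_{n\ge -1}$ satisfies $$(n+1)^r u_{n+1}=P(n)u_n-cn^ru_{n-1}\qquad (n=0,1,2,\ldots).$$ Define \begin{align*} s_n(x) = {}& \frac{2a_3}{x+1} n^3 + \Big(\frac{2a_2}{x+1} -\frac{6a_3}{(x+1)^2}\Big)n^2 +\Big( \frac{2a_1}{x+1} - \frac{4a_2}{(x+1)^2} - \frac{6a_3 (x-1)}{(x+1)^3}\Big) n \\ &+ \frac{2a_0}{x+1} - \frac{2a_1}{(x+1)^2} -\frac{2a_2(x-1)}{(x+1)^3} -\frac{2a_3(x^2-4x+1)}{(x+1)^4} \end{align*} and $$P_r(n,x)=\frac cx(n+1)^{2r}-cx\,n^{2r}-P(n)^2+x\,s_{n}(x)P(n).$$ Then for every positive integer $p$, $$\sum_{n=0}^{p-1}P_r(n,x)\frac{u_n^2}{(cx)^n}-\frac 1{(cx)^{p-1}}\Big(p^{2r}u_p^2+\frac cx p^{2r}u_{p-1}^2-p^rs_p(x)u_pu_{p-1}\Big)=\begin{cases}0&\text{if } r>0,\\ -cx\big(u_0^2+\frac cx u_{-1}^2-s_0(x)u_0u_{-1}\big)&\text{if } r=0.\end{cases}$$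
   Context: Convention: $0^0=1$ (so for $r=0$ one has $n^r=n^{2r}=1$ for all $n\ge 0$), and $0^r=0$ for $r>0$. *)

theory Defs
  imports Complex_Main
begin

text \<open>
  Powers with a nonnegative base and a nonnegative real exponent, with the convention
  \<open>0^0 = 1\<close>.  The library has \<open>0 powr r = 0\<close> for every \<open>r\<close>, including \<open>r = 0\<close>.
\<close>
definition rpow :: "real \<Rightarrow> real \<Rightarrow> real" where
  "rpow y r = (if r = 0 then 1 else y powr r)"

definition cubic :: "real \<Rightarrow> real \<Rightarrow> real \<Rightarrow> real \<Rightarrow> nat \<Rightarrow> real" where
  "cubic a0 a1 a2 a3 n = a3 * real n ^ 3 + a2 * real n ^ 2 + a1 * real n + a0"

definition s_seq :: "real \<Rightarrow> real \<Rightarrow> real \<Rightarrow> real \<Rightarrow> nat \<Rightarrow> real \<Rightarrow> real" where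
  "s_seq a0 a1 a2 a3 n x =
     2 * a3 / (x + 1) * real n ^ 3
     + (2 * a2 / (x + 1) - 6 * a3 / (x + 1) ^ 2) * real n ^ 2
     + (2 * a1 / (x + 1) - 4 * a2 / (x + 1) ^ 2 - 6 * a3 * (x - 1) / (x + 1) ^ 3) * real n
     + 2 * a0 / (x + 1) - 2 * a1 / (x + 1) ^ 2 - 2 * a2 * (x - 1) / (x + 1) ^ 3
     - 2 * a3 * (x ^ 2 - 4 * x + 1) / (x + 1) ^ 4"

definition Pr :: "real \<Rightarrow> real \<Rightarrow> real \<Rightarrow> real \<Rightarrow> real \<Rightarrow> real \<Rightarrow> nat \<Rightarrow> real \<Rightarrow> real" where
  "Pr a0 a1 a2 a3 c r n x =
     c / x * rpow (real n + 1) (2 * r) - c * x * rpow (real n) (2 * r)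
     - (cubic a0 a1 a2 a3 n) ^ 2 + x * s_seq a0 a1 a2 a3 n x * cubic a0 a1 a2 a3 n"

end

theory Submission
  imports Defs
begin

text \<open>
  The sum telescopes.  Put \<open>w n = n\<^sup>r\<close> and
  \<open>T n = w(n)\<^sup>2 u\<^sub>n\<^sup>2 + (c/x) w(n)\<^sup>2 u\<^bsub>n-1\<^esub>\<^sup>2 - w(n) s\<^sub>n u\<^sub>n u\<^bsub>n-1\<^esub>\<close>.
  Eliminating \<open>u\<^bsub>n+1\<^esub>\<close> from \<open>T (n + 1) - c x T n\<close> by the recurrence leaves a quadratic form
  in \<open>u\<^sub>n\<close> and \<open>u\<^bsub>n-1\<^esub>\<close>.  Its \<open>u\<^bsub>n-1\<^esub>\<^sup>2\<close> term cancels because of the factor \<open>c/x\<close> in \<open>T\<close>,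
  and its mixed term is \<open>c w(n) (s\<^bsub>n+1\<^esub> + x s\<^sub>n - 2 P(n)) u\<^sub>n u\<^bsub>n-1\<^esub>\<close>.  The polynomial
  \<open>s\<^sub>n\<close> is the polynomial solution of \<open>s\<^bsub>n+1\<^esub> + x s\<^sub>n = 2 P(n)\<close> (lemma \<open>s_seq_recurrence\<close>),
  so only a multiple of \<open>u\<^sub>n\<^sup>2\<close> survives, and its coefficient is \<open>P\<^sub>r(n,x)\<close>
  (lemma \<open>quadratic_form_step\<close>).  Dividing by \<open>(c x)\<^sup>n\<close> and summing leaves the two boundary
  terms, and the one at \<open>n = 0\<close> vanishes unless \<open>r = 0\<close>, since \<open>w 0 = 0\<close> for \<open>r > 0\<close>.
\<close>

lemma rpow_double:
  assumes "y \<ge> 0"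
  shows "rpow y (2 * r) = (rpow y r)\<^sup>2"
  using assms by (simp add: rpow_def power2_eq_square flip: powr_add)

text \<open>
  Comparing coefficients of \<open>n\<^sup>3, n\<^sup>2, n, 1\<close> in this equation gives a triangular linear system
  with \<open>x + 1\<close> on the diagonal; its solution is the formula for \<open>s_seq\<close>.
\<close>
lemma s_seq_recurrence:
  assumes "x + 1 \<noteq> 0"
  shows "s_seq a0 a1 a2 a3 (Suc n) x + x * s_seq a0 a1 a2 a3 n x = 2 * cubic a0 a1 a2 a3 n"
proof -
  define d where "d = 1 / (x + 1)"
  have xd: "x * d = 1 - d"
    using assms by (simp add: d_def field_simps)
  \<comment> \<open>With \<open>d\<close> as an indeterminate, the claim is a polynomial identity modulo \<open>x d = 1 - d\<close>.\<close>
  have s: "s_seq a0 a1 a2 a3 m x =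
      2 * a3 * d * real m ^ 3 + (2 * a2 * d - 6 * a3 * d ^ 2) * real m ^ 2
      + (2 * a1 * d - 4 * a2 * d ^ 2 - 6 * a3 * (x - 1) * d ^ 3) * real m
      + 2 * a0 * d - 2 * a1 * d ^ 2 - 2 * a2 * (x - 1) * d ^ 3
      - 2 * a3 * (x ^ 2 - 4 * x + 1) * d ^ 4" for m
    by (simp add: s_seq_def d_def power_one_over divide_inverse power_inverse)
  show ?thesis
    unfolding s cubic_def of_nat_Suc using xd by algebra
qed

text \<open>
  One step of the telescoping, with \<open>v, u, u'\<close> for three consecutive values of the sequence,
  \<open>w, w'\<close> for the two consecutive weights and \<open>s, s'\<close> for consecutive values of the
  coefficient of the mixed term.
\<close>
lemma quadratic_form_step:
  fixes c x :: "'a :: field"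
  assumes "x \<noteq> 0"
    and rec: "w' * u' = P * u - c * w * v"
    and s: "s' + x * s = 2 * P"
  shows "(w'\<^sup>2 * u'\<^sup>2 + c / x * w'\<^sup>2 * u\<^sup>2 - w' * s' * u' * u)
       - c * x * (w\<^sup>2 * u\<^sup>2 + c / x * w\<^sup>2 * v\<^sup>2 - w * s * u * v)
       = (c / x * w'\<^sup>2 - c * x * w\<^sup>2 - P\<^sup>2 + x * s * P) * u\<^sup>2"
proof -
  define e where "e = c / x"
  have e: "e * x = c"
    using assms(1) by (simp add: e_def)
  show ?thesis
    unfolding e_def[symmetric] using rec s e by algebra
qed

lemma sum_weighted_telescope:
  fixes T f :: "nat \<Rightarrow> 'a :: field"
  assumes "q \<noteq> 0" and "\<And>n. T (Suc n) - q * T n = f n"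
  shows "(\<Sum>n<Suc m. f n / q ^ n) = T (Suc m) / q ^ m - q * T 0"
proof -
  have "f n / q ^ n = q * T (Suc n) / q ^ Suc n - q * T n / q ^ n" for n
    using assms(1) by (simp add: diff_divide_distrib flip: assms(2))
  then have "(\<Sum>n<Suc m. f n / q ^ n) = q * T (Suc m) / q ^ Suc m - q * T 0 / q ^ 0"
    using sum_lessThan_telescope[of "\<lambda>n. q * T n / q ^ n" "Suc m"] by presburger
  then show ?thesis
    using assms(1) by simp
qed

theorem theorem2p1:
  fixes c x a0 a1 a2 a3 r :: real
    and u :: "int \<Rightarrow> real"
    and p :: nat
  assumes "c * x * (x + 1) \<noteq> 0"
    and "r \<ge> 0"
    and "\<And>n::nat. rpow (real n + 1) r * u (int n + 1)
           = cubic a0 a1 a2 a3 n * u (int n) - c * rpow (real n) r * u (int n - 1)"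
    and "p \<ge> 1"
  shows "(\<Sum>n=0..p-1. Pr a0 a1 a2 a3 c r n x * ((u (int n))\<^sup>2 / (c * x) ^ n))
     - 1 / (c * x) ^ (p - 1)
       * (rpow (real p) (2 * r) * (u (int p))\<^sup>2
          + c / x * rpow (real p) (2 * r) * (u (int p - 1))\<^sup>2
          - rpow (real p) r * s_seq a0 a1 a2 a3 p x * u (int p) * u (int p - 1))
     = (if r > 0 then 0
        else - (c * x) * ((u 0)\<^sup>2 + c / x * (u (-1))\<^sup>2 - s_seq a0 a1 a2 a3 0 x * u 0 * u (-1)))"
proof -
  have nz: "x \<noteq> 0" "x + 1 \<noteq> 0" "c * x \<noteq> 0"
    using assms(1) by auto
  define w where "w n = rpow (real n) r" for n
  define s where "s n = s_seq a0 a1 a2 a3 n x" for n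
  define T where "T n = (w n)\<^sup>2 * (u (int n))\<^sup>2 + c / x * (w n)\<^sup>2 * (u (int n - 1))\<^sup>2
    - w n * s n * u (int n) * u (int n - 1)" for n
  have w_sq: "rpow (real n) (2 * r) = (w n)\<^sup>2" for n
    by (simp add: w_def rpow_double)
  have step: "T (Suc n) - c * x * T n = Pr a0 a1 a2 a3 c r n x * (u (int n))\<^sup>2" for n
  proof -
    have rec: "w (Suc n) * u (int n + 1)
        = cubic a0 a1 a2 a3 n * u (int n) - c * w n * u (int n - 1)"
      using assms(3)[of n] by (simp add: w_def add.commute)
    have "rpow (real n + 1) (2 * r) = (w (Suc n))\<^sup>2"
      using w_sq[of "Suc n"] by (simp add: add.commute)
    then show ?thesis
      using quadratic_form_step[OF nz(1) rec s_seq_recurrence[OF nz(2)]]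
      by (simp add: T_def Pr_def w_sq s_def add.commute)
  qed
  obtain m where m: "p = Suc m"
    using assms(4) by (cases p) auto
  have "(\<Sum>n=0..p-1. Pr a0 a1 a2 a3 c r n x * ((u (int n))\<^sup>2 / (c * x) ^ n))
      = T p / (c * x) ^ (p - 1) - c * x * T 0"
    using sum_weighted_telescope[of "c * x" T, OF nz(3) step, of m]
    by (simp add: m atLeast0AtMost lessThan_Suc_atMost)
  moreover have "T 0 = (if r > 0 then 0
      else (u 0)\<^sup>2 + c / x * (u (-1))\<^sup>2 - s_seq a0 a1 a2 a3 0 x * u 0 * u (-1))"
    using assms(2) by (simp add: T_def w_def s_def rpow_def)
  ultimately show ?thesis
    by (simp add: T_def w_sq s_def flip: w_def)
qed

end
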